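(* The uniform density zero ideal $\mathcal{Z}_u$ on $\omega$ contains no cotowers.
   Context: $A\subseteq^* B$ means that $A\setminus B$ is finite. Ideals on a countably infinite set $\Omega$ are assumed to be proper and to contain all finite subsets of $\Omega$. A tower on $\Omega$ is a sequence $(T_\alpha)_{\alpha<\kappa}$ of infinite subsets of $\Omega$, with $\kappa$ a cardinal, such that $T_\beta\subseteq^* T_\alpha$ whenever $\alpha\le\beta<\kappa$, and which has no pseudointersection, i.e. there is no infinite $X\subseteq\Omega$ with $X\subseteq^* T_\alpha$ for all $\alpha<\kappa$. A cotower in an ideal $\mathcal{I}$ on $\Omega$ is a sequence $(A_\alpha)_{\alpha<\kappa}$ of elements of $\mathcal{I}$ such that $(\Omega\setminus A_\alpha)_{\alpha<\kappa}$ is a tower. For $A\subseteq\omega$ and $n\in\omega$ let $S_n(A)=\max\{|A\cap[k,k+n)|:k\in\omega\}$. The uniform density zero ideal is $\mathcal{Z}_u=\{A\subseteq\omega:\lim_{n\to\infty}S_n(A)/n=0\}$. *)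

theory Defs
  imports Complex_Main "HOL-Library.Countable_Set"
begin

definition almost_subset :: "'a set \<Rightarrow> 'a set \<Rightarrow> bool"  (infix \<open>\<subseteq>\<^sup>*\<close> 50)
  where "A \<subseteq>\<^sup>* B \<longleftrightarrow> finite (A - B)"

definition ideal_on :: "'a set \<Rightarrow> 'a set set \<Rightarrow> bool"
  where "ideal_on \<Omega> I \<longleftrightarrow>
    countable \<Omega> \<and> infinite \<Omega> \<and> I \<subseteq> Pow \<Omega> \<and>
    (\<forall>A\<in>I. \<forall>B. B \<subseteq> A \<longrightarrow> B \<in> I) \<and>
    (\<forall>A\<in>I. \<forall>B\<in>I. A \<union> B \<in> I) \<and>
    \<Omega> \<notin> I \<and>
    (\<forall>F. F \<subseteq> \<Omega> \<and> finite F \<longrightarrow> F \<in> I)"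

text \<open>
  A cardinal is a relation \<open>\<kappa>\<close> with \<open>Card_order \<kappa>\<close>: a well-order on its field, of least
  possible order type. A sequence of length \<open>\<kappa>\<close> is a function whose values matter only on
  \<open>Field \<kappa>\<close>, and \<open>(\<alpha>, \<beta>) \<in> \<kappa>\<close> means \<open>\<alpha> \<le> \<beta> < \<kappa>\<close>. The index type is arbitrary.
\<close>

definition pseudointersection ::
    "'a set \<Rightarrow> 'i rel \<Rightarrow> ('i \<Rightarrow> 'a set) \<Rightarrow> 'a set \<Rightarrow> bool"
  where "pseudointersection \<Omega> \<kappa> T X \<longleftrightarrow>
    X \<subseteq> \<Omega> \<and> infinite X \<and> (\<forall>\<alpha>\<in>Field \<kappa>. X \<subseteq>\<^sup>* T \<alpha>)"

definition tower :: "'a set \<Rightarrow> 'i rel \<Rightarrow> ('i \<Rightarrow> 'a set) \<Rightarrow> bool"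
  where "tower \<Omega> \<kappa> T \<longleftrightarrow>
    Card_order \<kappa> \<and>
    (\<forall>\<alpha>\<in>Field \<kappa>. T \<alpha> \<subseteq> \<Omega> \<and> infinite (T \<alpha>)) \<and>
    (\<forall>\<alpha> \<beta>. (\<alpha>, \<beta>) \<in> \<kappa> \<longrightarrow> T \<beta> \<subseteq>\<^sup>* T \<alpha>) \<and>
    (\<nexists>X. pseudointersection \<Omega> \<kappa> T X)"

definition cotower_in ::
    "'a set \<Rightarrow> 'a set set \<Rightarrow> 'i rel \<Rightarrow> ('i \<Rightarrow> 'a set) \<Rightarrow> bool"
  where "cotower_in \<Omega> I \<kappa> A \<longleftrightarrow>
    (\<forall>\<alpha>\<in>Field \<kappa>. A \<alpha> \<in> I) \<and> tower \<Omega> \<kappa> (\<lambda>\<alpha>. \<Omega> - A \<alpha>)"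

definition max_window :: "nat \<Rightarrow> nat set \<Rightarrow> nat"
  where "max_window n A = Max {card (A \<inter> {k..<k + n}) | k. True}"

definition Z_u :: "nat set set"
  where "Z_u = {A. (\<lambda>n. real (max_window n A) / real n) \<longlonglongrightarrow> 0}"

lemma finite_windows: "finite {card (A \<inter> {k..<k + n}) | k :: nat. True}"
proof (rule finite_subset)
  have "card (A \<inter> {k..<k + n}) \<le> n" for k
    using card_mono[of "{k..<k + n}" "A \<inter> {k..<k + n}"] by simp
  then show "{card (A \<inter> {k..<k + n}) | k. True} \<subseteq> {..n}" by auto
qed simp

lemma card_le_max_window: "card (A \<inter> {k..<k + n}) \<le> max_window n A"
  unfolding max_window_def by (rule Max_ge[OF finite_windows]) blast

lemma max_window_le: "max_window n A \<le> m" if "\<And>k. card (A \<inter> {k..<k + n}) \<le> m"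
  unfolding max_window_def
  by (subst Max_le_iff[OF finite_windows]) (use that in auto)

lemma Z_uI:
  assumes "g \<longlonglongrightarrow> 0" "\<And>n. real (max_window n A) / real n \<le> g n"
  shows "A \<in> Z_u"
  unfolding Z_u_def mem_Collect_eq
proof (rule tendsto_sandwich[OF _ _ tendsto_const assms(1)])
  show "\<forall>\<^sub>F n in sequentially. 0 \<le> real (max_window n A) / real n" by simp
  show "\<forall>\<^sub>F n in sequentially. real (max_window n A) / real n \<le> g n"
    by (rule always_eventually) (use assms(2) in blast)
qed

lemma Z_uD: "A \<in> Z_u \<Longrightarrow> (\<lambda>n. real (max_window n A) / real n) \<longlonglongrightarrow> 0"
  unfolding Z_u_def by (rule CollectD)

lemma Z_u_ideal: "ideal_on UNIV Z_u"
proof -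
  have sub: "B \<in> Z_u" if "A \<in> Z_u" "B \<subseteq> A" for A B
  proof -
    have "max_window n B \<le> max_window n A" for n
    proof (rule max_window_le)
      fix k
      have "card (B \<inter> {k..<k + n}) \<le> card (A \<inter> {k..<k + n})"
        using that(2) by (intro card_mono) auto
      then show "card (B \<inter> {k..<k + n}) \<le> max_window n A"
        using card_le_max_window le_trans by blast
    qed
    then have "real (max_window n B) / real n \<le> real (max_window n A) / real n" for n
      by (simp add: divide_right_mono)
    then show ?thesis by (rule Z_uI[OF Z_uD[OF that(1)]])
  qed
  have un: "A \<union> B \<in> Z_u" if "A \<in> Z_u" "B \<in> Z_u" for A B
  proof -
    have "max_window n (A \<union> B) \<le> max_window n A + max_window n B" for n
    proof (rule max_window_le)
      fix k
      have "card ((A \<union> B) \<inter> {k..<k + n}) \<le> card (A \<inter> {k..<k + n}) + card (B \<inter> {k..<k + n})"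
        by (simp add: Int_Un_distrib2 card_Un_le)
      then show "card ((A \<union> B) \<inter> {k..<k + n}) \<le> max_window n A + max_window n B"
        using card_le_max_window[of A k n] card_le_max_window[of B k n] by linarith
    qed
    then have le: "real (max_window n (A \<union> B)) / real n
        \<le> real (max_window n A) / real n + real (max_window n B) / real n" for n
      by (metis add_divide_distrib divide_right_mono of_nat_0_le_iff of_nat_add of_nat_mono)
    have "(\<lambda>n. real (max_window n A) / real n + real (max_window n B) / real n) \<longlonglongrightarrow> 0"
      using tendsto_add[OF Z_uD[OF that(1)] Z_uD[OF that(2)]] by simp
    then show ?thesis using le by (rule Z_uI)
  qed
  have fin: "F \<in> Z_u" if "finite F" for F
  proof -
    have "max_window n F \<le> card F" for n
      by (rule max_window_le) (simp add: card_mono that)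
    then have le: "real (max_window n F) / real n \<le> real (card F) / real n" for n
      by (simp add: divide_right_mono)
    have "(\<lambda>n. real (card F) / real n) \<longlonglongrightarrow> 0"
      by (rule lim_const_over_n)
    then show ?thesis using le by (rule Z_uI)
  qed
  have proper: "UNIV \<notin> Z_u"
  proof
    assume "UNIV \<in> Z_u"
    note lim = Z_uD[OF this]
    have "n \<le> max_window n UNIV" for n
      using card_le_max_window[of UNIV 0 n] by simp
    then have "\<forall>n\<ge>1. (1::real) \<le> real (max_window n UNIV) / real n"
      by simp
    then have "(1::real) \<le> 0" using LIMSEQ_le_const[OF lim] by blast
    then show False by simp
  qed
  show ?thesis
    unfolding ideal_on_def
  proof (intro conjI ballI allI impI)
    show "countable (UNIV :: nat set)" "infinite (UNIV :: nat set)" by simp_all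
    show "Z_u \<subseteq> Pow UNIV" by simp
    show "UNIV \<notin> Z_u" by (rule proper)
  qed (erule (1) sub un | elim conjE, erule fin)+
qed

end

(*
  Every set in Z_u omits a point of every window of some length n > 0. If the indices are
  cofinal through witnesses with the same n, cut \<omega> into blocks of length n: every member of the
  tower meets almost every block, and the least number m of points that some member T has in
  infinitely many blocks is positive. The part of T in its blocks with m points cannot shrink in
  infinitely many blocks later on, so it is a pseudointersection. If no n is cofinal, bounds for
  the individual n form a countable cofinal set of indices, and diagonalization gives a
  pseudointersection.
*)
theory Submission
  imports Defs
begin

lemma almost_subset_trans: "A \<subseteq>\<^sup>* B \<Longrightarrow> B \<subseteq>\<^sup>* C \<Longrightarrow> A \<subseteq>\<^sup>* C"
  unfolding almost_subset_def by (rule finite_subset[of _ "(A - B) \<union> (B - C)"]) auto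

text \<open>Diagonalization: pick \<open>x n\<close> from the first n + 1 sets, away from all
  earlier picks. The range is then infinite, and only \<open>x k\<close> with k < n can lie outside
  \<open>T n\<close>.\<close>

lemma pseudointersection_of_sequence:
  fixes T :: "nat \<Rightarrow> 'a set"
  assumes "\<And>n. infinite (\<Inter>i\<le>n. T i)"
  shows "\<exists>X. infinite X \<and> (\<forall>n. X \<subseteq>\<^sup>* T n)"
proof -
  have "\<exists>x :: nat \<Rightarrow> 'a. \<forall>n. x n \<in> (\<Inter>i\<le>n. T i) - x ` {..<n}"
  proof (rule dependent_wellorder_choice)
    fix n and f :: "nat \<Rightarrow> 'a"
    have "infinite ((\<Inter>i\<le>n. T i) - f ` {..<n})"
      using assms by (intro Diff_infinite_finite) auto
    then show "\<exists>y. y \<in> (\<Inter>i\<le>n. T i) - f ` {..<n}"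
      using infinite_imp_nonempty by blast
  next
    \<comment> \<open>The recursion is legitimate because the condition on the n-th value reads only
      the values before n.\<close>
    fix r :: 'a and f g :: "nat \<Rightarrow> 'a" and n
    assume "\<And>m. m < n \<Longrightarrow> f m = g m"
    then have "f ` {..<n} = g ` {..<n}" by (intro image_cong) auto
    then show "(r \<in> (\<Inter>i\<le>n. T i) - f ` {..<n}) = (r \<in> (\<Inter>i\<le>n. T i) - g ` {..<n})"
      by simp
  qed
  then obtain x where "\<forall>n. x n \<in> (\<Inter>i\<le>n. T i) - x ` {..<n}" ..
  then have x: "x n \<in> (\<Inter>i\<le>n. T i)" "x n \<notin> x ` {..<n}" for n by simp_all
  have "inj x"
  proof (rule linorder_injI)
    fix m n :: nat assume "m < n"
    then show "x m \<noteq> x n" using x(2)[of n] by (metis imageI lessThan_iff)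
  qed
  then have "infinite (range x)" by (rule range_inj_infinite)
  moreover have "range x \<subseteq>\<^sup>* T n" for n
  proof -
    have "range x - T n \<subseteq> x ` {..<n}"
    proof
      fix y assume "y \<in> range x - T n"
      then obtain k where k: "y = x k" "x k \<notin> T n" by blast
      then have "\<not> n \<le> k" using x(1)[of k] by auto
      then show "y \<in> x ` {..<n}" using k(1) by simp
    qed
    then show ?thesis unfolding almost_subset_def by (rule finite_subset) simp
  qed
  ultimately show ?thesis by blast
qed

lemma total_on_finite_upper_bound:
  assumes "trans r" "\<And>x y. x \<in> Field r \<Longrightarrow> y \<in> Field r \<Longrightarrow> (x, y) \<in> r \<or> (y, x) \<in> r"
    and "finite B" "B \<noteq> {}" "B \<subseteq> Field r"
  shows "\<exists>z\<in>Field r. \<forall>x\<in>B. (x, z) \<in> r"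
  using assms(3-5)
proof (induction B rule: finite_ne_induct)
  case (singleton x)
  then show ?case using assms(2)[of x x] by auto
next
  case (insert x B)
  then obtain z where z: "z \<in> Field r" "\<forall>y\<in>B. (y, z) \<in> r" by auto
  have "x \<in> Field r" using insert.prems by simp
  \<comment> \<open>The hypothesis on comparability, taken at equal arguments, gives
    \<open>(x, x) \<in> r\<close>.\<close>
  then consider "(x, z) \<in> r" | "(z, x) \<in> r" "(x, x) \<in> r" using assms(2) z(1) by blast
  then show ?case
  proof cases
    case 1
    with z show ?thesis by blast
  next
    case 2
    then have "\<forall>y\<in>insert x B. (y, x) \<in> r" using z(2) assms(1) by (auto dest: transD)
    with \<open>x \<in> Field r\<close> show ?thesis by blast
  qed
qed

text \<open>Finitely many indices \<open>c i\<close> have a common upper bound \<open>z\<close>, and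
  the infinite set \<open>T z\<close> is almost contained in each \<open>T (c i)\<close>. So finite
  intersections along \<open>c\<close> are infinite and the diagonalization applies; cofinality
  carries the result to all indices.\<close>

lemma pseudointersection_of_countable_cofinality:
  fixes c :: "nat \<Rightarrow> 'i" and T :: "'i \<Rightarrow> 'a set"
  assumes "trans r" "\<And>x y. x \<in> Field r \<Longrightarrow> y \<in> Field r \<Longrightarrow> (x, y) \<in> r \<or> (y, x) \<in> r"
    and inf: "\<And>\<alpha>. \<alpha> \<in> Field r \<Longrightarrow> infinite (T \<alpha>)"
    and dec: "\<And>\<alpha> \<beta>. (\<alpha>, \<beta>) \<in> r \<Longrightarrow> T \<beta> \<subseteq>\<^sup>* T \<alpha>"
    and c: "\<And>n. c n \<in> Field r"
    and cofinal: "\<And>\<beta>. \<beta> \<in> Field r \<Longrightarrow> \<exists>n. (\<beta>, c n) \<in> r"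
  shows "\<exists>X. infinite X \<and> (\<forall>\<alpha>\<in>Field r. X \<subseteq>\<^sup>* T \<alpha>)"
proof -
  have "infinite (\<Inter>i\<le>n. T (c i))" for n
  proof
    assume fin: "finite (\<Inter>i\<le>n. T (c i))"
    obtain z where z: "z \<in> Field r" "\<forall>x\<in>c ` {..n}. (x, z) \<in> r"
      using total_on_finite_upper_bound[OF assms(1,2), of "c ` {..n}"] c by blast
    have "T z \<subseteq> (\<Inter>i\<le>n. T (c i)) \<union> (\<Union>i\<le>n. T z - T (c i))" by blast
    moreover have "finite (\<Union>i\<le>n. T z - T (c i))"
      using dec z(2) unfolding almost_subset_def by (intro finite_UN_I) blast+
    ultimately show False using inf[OF z(1)] fin by (meson finite_UnI finite_subset)
  qed
  then obtain X where X: "infinite X" "\<And>n. X \<subseteq>\<^sup>* T (c n)"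
    using pseudointersection_of_sequence[of "\<lambda>n. T (c n)"] by blast
  moreover have "X \<subseteq>\<^sup>* T \<beta>" if \<beta>: "\<beta> \<in> Field r" for \<beta>
  proof -
    obtain n where "(\<beta>, c n) \<in> r" using cofinal[OF \<beta>] by blast
    then show ?thesis using almost_subset_trans[OF X(2) dec] by blast
  qed
  ultimately show ?thesis by blast
qed

text \<open>The fibres of \<open>f\<close> stand for the blocks. For the least count m attained in
  infinitely many fibres, later members almost never drop below m, while almost decreasing keeps
  them from gaining points in all but finitely many fibres.\<close>

lemma pseudointersection_of_bounded_fibres:
  fixes f :: "'a \<Rightarrow> 'b" and T :: "'i \<Rightarrow> 'a set"
  assumes total: "\<And>x y. x \<in> Field r \<Longrightarrow> y \<in> Field r \<Longrightarrow> (x, y) \<in> r \<or> (y, x) \<in> r"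
    and "Field r \<noteq> {}"
    and dec: "\<And>\<alpha> \<beta>. (\<alpha>, \<beta>) \<in> r \<Longrightarrow> T \<beta> \<subseteq>\<^sup>* T \<alpha>"
    and "infinite (UNIV :: 'b set)"
    and fibre: "\<And>j. finite (f -` {j})" "\<And>j. card (f -` {j}) \<le> n"
    and meets: "\<And>\<alpha>. \<alpha> \<in> Field r \<Longrightarrow> finite {j. T \<alpha> \<inter> f -` {j} = {}}"
  shows "\<exists>X. infinite X \<and> (\<forall>\<alpha>\<in>Field r. X \<subseteq>\<^sup>* T \<alpha>)"
proof -
  define N where "N \<alpha> j = card (T \<alpha> \<inter> f -` {j})" for \<alpha> j
  define P where "P m \<longleftrightarrow> (\<exists>\<alpha>\<in>Field r. infinite {j. N \<alpha> j = m})" for m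
  have fin: "finite (T \<alpha> \<inter> f -` {j})" for \<alpha> j
    using fibre(1) by blast
  have "\<exists>m. P m"
  proof (rule ccontr)
    assume no: "\<nexists>m. P m"
    obtain \<alpha> where "\<alpha> \<in> Field r" using assms(2) by blast
    \<comment> \<open>Pigeonhole: infinitely many fibres share the finitely many counts 0, ...,
      n.\<close>
    have "N \<alpha> j \<le> n" for j
      unfolding N_def using card_mono[OF fibre(1)] fibre(2) by (meson inf_le2 le_trans)
    then have "UNIV = (\<Union>m\<le>n. {j. N \<alpha> j = m})" by blast
    moreover have "finite (\<Union>m\<le>n. {j. N \<alpha> j = m})"
      using no \<open>\<alpha> \<in> Field r\<close> unfolding P_def by simp
    ultimately show False using assms(4) by simp
  qed
  define m where "m = (LEAST m. P m)"
  have "P m" unfolding m_def using \<open>\<exists>m. P m\<close> by (rule LeastI_ex)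
  then obtain \<alpha> where \<alpha>: "\<alpha> \<in> Field r" and J: "infinite {j. N \<alpha> j = m}"
    unfolding P_def by blast
  have "m > 0"
  proof (rule gr0I)
    assume "m = 0"
    then have "{j. N \<alpha> j = m} = {j. T \<alpha> \<inter> f -` {j} = {}}"
      unfolding N_def using fin by simp
    then show False using J meets[OF \<alpha>] by simp
  qed
  define X where "X = {x \<in> T \<alpha>. N \<alpha> (f x) = m}"
  have "infinite X"
  proof
    assume "finite X"
    \<comment> \<open>As m is positive, every fibre with count m contributes a point to
      \<open>X\<close>.\<close>
    have "j \<in> f ` X" if j: "N \<alpha> j = m" for j
    proof -
      have "T \<alpha> \<inter> f -` {j} \<noteq> {}" using j \<open>m > 0\<close> unfolding N_def by force
      then show ?thesis using j unfolding X_def by blast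
    qed
    then have "{j. N \<alpha> j = m} \<subseteq> f ` X" by blast
    then show False using J \<open>finite X\<close> finite_surj by blast
  qed
  moreover have "X \<subseteq>\<^sup>* T \<beta>" if \<beta>: "\<beta> \<in> Field r" for \<beta>
    using total[OF \<alpha> \<beta>]
  proof
    assume "(\<beta>, \<alpha>) \<in> r"
    then have "T \<alpha> \<subseteq>\<^sup>* T \<beta>" by (rule dec)
    then show ?thesis
      unfolding almost_subset_def by (rule rev_finite_subset) (auto simp: X_def)
  next
    assume "(\<alpha>, \<beta>) \<in> r"
    then have D: "finite (T \<beta> - T \<alpha>)" using dec unfolding almost_subset_def by blast
    \<comment> \<open>These are the fibres in which \<open>T \<beta>\<close> has dropped below m
      points; minimality of m leaves only finitely many.\<close>
    define E where "E = (\<Union>k<m. {j. N \<beta> j = k})"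
    have "finite {j. N \<beta> j = k}" if "k < m" for k
    proof -
      have "\<not> P k" using that unfolding m_def by (rule not_less_Least)
      then show ?thesis using \<beta> unfolding P_def by blast
    qed
    then have E: "finite E" unfolding E_def by simp
    have "X - T \<beta> \<subseteq> (\<Union>j\<in>f ` (T \<beta> - T \<alpha>) \<union> E. f -` {j})"
    proof
      fix x assume x: "x \<in> X - T \<beta>"
      \<comment> \<open>In any other fibre \<open>T \<beta>\<close> lies inside
        \<open>T \<alpha>\<close> and has at least as many points there, so the two traces coincide
        and \<open>x\<close> lies in \<open>T \<beta>\<close>.\<close>
      have "f x \<in> f ` (T \<beta> - T \<alpha>) \<union> E"
      proof (rule ccontr)
        assume not: "f x \<notin> f ` (T \<beta> - T \<alpha>) \<union> E"
        then have "T \<beta> \<inter> f -` {f x} \<subseteq> T \<alpha> \<inter> f -` {f x}"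
          by (auto simp: image_iff) (metis DiffI)
        moreover have "\<not> N \<beta> (f x) < m" using not unfolding E_def by simp
        then have "N \<beta> (f x) \<ge> N \<alpha> (f x)" using x unfolding X_def by simp
        ultimately have "T \<beta> \<inter> f -` {f x} = T \<alpha> \<inter> f -` {f x}"
          unfolding N_def by (intro card_seteq fin) auto
        then show False using x unfolding X_def by blast
      qed
      then show "x \<in> (\<Union>j\<in>f ` (T \<beta> - T \<alpha>) \<union> E. f -` {j})"
        by (rule UN_I) simp
    qed
    moreover have "finite (\<Union>j\<in>f ` (T \<beta> - T \<alpha>) \<union> E. f -` {j})"
      using D E fibre(1) by (intro finite_UN_I finite_UnI finite_imageI)
    ultimately show ?thesis unfolding almost_subset_def by (rule finite_subset)
  qed
  ultimately show ?thesis by blast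
qed

lemma Z_u_max_window_less:
  assumes "A \<in> Z_u"
  shows "\<exists>n>0. max_window n A < n"
proof -
  have "\<forall>\<^sub>F n in sequentially. real (max_window n A) / real n < 1"
    using Z_uD[OF assms] by (rule order_tendstoD) simp
  \<comment> \<open>Positivity has to be added: 0 / 0 is 0, so n = 0 satisfies the bound on the
    quotient but not the strict inequality.\<close>
  then have "\<forall>\<^sub>F n in sequentially. n > 0 \<and> real (max_window n A) / real n < 1"
    using eventually_gt_at_top[of 0] by eventually_elim simp
  then obtain n where "n > 0" "real (max_window n A) / real n < 1"
    using eventually_happens by force
  then show ?thesis by (intro exI[of _ n]) (simp add: field_simps)
qed

text \<open>This presents the blocks of length n as fibres of a map, each of them a window in the
  sense of \<open>max_window\<close>.\<close>

lemma div_vimage_eq: "(\<lambda>x. x div n) -` {j} = {j * n..<j * n + n}" if "n > 0" for n j :: nat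
  using that by (auto simp: div_nat_eqI mult.commute add.commute dividend_less_times_div)

theorem mainTheorem3:
  fixes \<kappa> :: "'i rel" and A :: "'i \<Rightarrow> nat set"
  shows "\<not> cotower_in (UNIV :: nat set) Z_u \<kappa> A"
proof
  assume cotower: "cotower_in (UNIV :: nat set) Z_u \<kappa> A"
  define T where "T \<alpha> = UNIV - A \<alpha>" for \<alpha>
  have Z: "A \<alpha> \<in> Z_u" and inf: "infinite (T \<alpha>)" if "\<alpha> \<in> Field \<kappa>" for \<alpha>
    using cotower that unfolding cotower_in_def tower_def T_def by auto
  have dec: "T \<beta> \<subseteq>\<^sup>* T \<alpha>" if "(\<alpha>, \<beta>) \<in> \<kappa>" for \<alpha> \<beta>
    using cotower that unfolding cotower_in_def tower_def T_def by blast
  have "\<nexists>X. pseudointersection UNIV \<kappa> T X" and "Card_order \<kappa>"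
    using cotower unfolding cotower_in_def tower_def T_def by blast+
  then have none: "\<nexists>X. infinite X \<and> (\<forall>\<alpha>\<in>Field \<kappa>. X \<subseteq>\<^sup>* T \<alpha>)"
    unfolding pseudointersection_def by blast
  have "Well_order \<kappa>" using \<open>Card_order \<kappa>\<close> by (rule card_order_on_well_order_on)
  then have lin: "Linear_order \<kappa>" unfolding well_order_on_def by (rule conjunct1)
  then have trans: "trans \<kappa>" unfolding order_on_defs by blast
  \<comment> \<open>\<open>total_on\<close> compares distinct elements; reflexivity covers x =
    y.\<close>
  have total: "(x, y) \<in> \<kappa> \<or> (y, x) \<in> \<kappa>" if "x \<in> Field \<kappa>" "y \<in> Field \<kappa>" for x y
    using lin that unfolding order_on_defs total_on_def refl_on_def by metis
  \<comment> \<open>Over an empty index set all of \<omega> would be a pseudointersection.\<close>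
  have ne: "Field \<kappa> \<noteq> {}"
    using none infinite_UNIV_nat by auto
  show False
  proof (cases "\<exists>n>0. \<forall>\<beta>\<in>Field \<kappa>. \<exists>\<gamma>. (\<beta>, \<gamma>) \<in> \<kappa> \<and> max_window n (A \<gamma>) < n")
    case True
    then obtain n where n: "n > 0"
      and ex: "\<And>\<beta>. \<beta> \<in> Field \<kappa> \<Longrightarrow> \<exists>\<gamma>. (\<beta>, \<gamma>) \<in> \<kappa> \<and> max_window n (A \<gamma>) < n"
      by blast
    let ?f = "\<lambda>x. x div n"
    have meets: "finite {j. T \<beta> \<inter> ?f -` {j} = {}}" if \<beta>: "\<beta> \<in> Field \<kappa>" for \<beta>
    proof -
      obtain \<gamma> where \<gamma>: "(\<beta>, \<gamma>) \<in> \<kappa>" "max_window n (A \<gamma>) < n" using ex[OF \<beta>] by blast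
      \<comment> \<open>\<open>T \<gamma>\<close> meets every block, since a block inside
        \<open>A \<gamma>\<close> would be a window with n points. A block missed by
        \<open>T \<beta>\<close> therefore contains one of the finitely many points of
        \<open>T \<gamma> - T \<beta>\<close>.\<close>
      have "j \<in> ?f ` (T \<gamma> - T \<beta>)" if j: "T \<beta> \<inter> ?f -` {j} = {}" for j
      proof -
        have "\<not> ?f -` {j} \<subseteq> A \<gamma>"
        proof
          assume "?f -` {j} \<subseteq> A \<gamma>"
          then have "A \<gamma> \<inter> {j * n..<j * n + n} = {j * n..<j * n + n}"
            using div_vimage_eq[OF n] by blast
          then show False using card_le_max_window[of "A \<gamma>" "j * n" n] \<gamma>(2) by simp
        qed
        then obtain x where "x \<in> ?f -` {j}" "x \<in> T \<gamma>" unfolding T_def by blast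
        then show ?thesis using j by blast
      qed
      then have "{j. T \<beta> \<inter> ?f -` {j} = {}} \<subseteq> ?f ` (T \<gamma> - T \<beta>)" by blast
      then show ?thesis
        using dec[OF \<gamma>(1)] unfolding almost_subset_def by (meson finite_surj)
    qed
    have "\<exists>X. infinite X \<and> (\<forall>\<alpha>\<in>Field \<kappa>. X \<subseteq>\<^sup>* T \<alpha>)"
      using total ne dec infinite_UNIV_nat
    proof (rule pseudointersection_of_bounded_fibres)
      show "finite (?f -` {j})" "card (?f -` {j}) \<le> n" for j
        by (simp_all add: div_vimage_eq[OF n])
    qed (assumption | rule meets)+
    then show False using none by blast
  next
    case False
    \<comment> \<open>At n = 0 the condition is void and any index serves, so that \<open>c\<close>
      is defined on all of \<omega>.\<close>
    then have "\<forall>n. \<exists>\<beta>\<in>Field \<kappa>. n > 0 \<longrightarrow> (\<forall>\<gamma>. (\<beta>, \<gamma>) \<in> \<kappa> \<longrightarrow> \<not> max_window n (A \<gamma>) < n)"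
      using ne by blast
    then obtain c where c: "\<And>n. c n \<in> Field \<kappa>"
      and full: "\<And>n \<gamma>. n > 0 \<Longrightarrow> (c n, \<gamma>) \<in> \<kappa> \<Longrightarrow> \<not> max_window n (A \<gamma>) < n"
      by metis
    \<comment> \<open>Some n > 0 has \<open>max_window n (A \<beta>) < n\<close>. By the choice of
      \<open>c n\<close>, \<beta> cannot lie above \<open>c n\<close>, so it lies below.\<close>
    have cofinal: "\<exists>n. (\<beta>, c n) \<in> \<kappa>" if \<beta>: "\<beta> \<in> Field \<kappa>" for \<beta>
      using Z_u_max_window_less[OF Z[OF \<beta>]] full total[OF \<beta> c] by blast
    have "\<exists>X. infinite X \<and> (\<forall>\<alpha>\<in>Field \<kappa>. X \<subseteq>\<^sup>* T \<alpha>)"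
      using trans total inf dec c cofinal by (rule pseudointersection_of_countable_cofinality)
    then show False using none by blast
  qed
qed

end
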